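(* Let $S$ and $T$ be strongly Morita equivalent inverse semigroups. Then there is an equivalence of categories $F\colon S_E\to T_E$.
   Context: An inverse semigroup is a semigroup $S$ such that for each $s\in S$ there is a unique $s^*\in S$ with $ss^*s=s$ and $s^*ss^*=s^*$; $E(S)$ is its set of idempotents. A Morita context is a 5-tuple $(S,T,X,\langle\ ,\ \rangle,[\ ,\ ])$ where $S,T$ are inverse semigroups, $X$ is a set with a left action of $S$ and a right action of $T$ that commute, and $\langle\ ,\ \rangle\colon X\times X\to S$, $[\ ,\ ]\colon X\times X\to T$ are surjective functions such that for all $x,y,z\in X$, $s\in S$, $t\in T$: (1) $\langle sx,y\rangle=s\langle x,y\rangle$; (2) $\langle y,x\rangle=\langle x,y\rangle^*$; (3) $\langle x,x\rangle x=x$; (4) $[x,yt]=[x,y]t$; (5) $[y,x]=[x,y]^*$; (6) $x[x,x]=x$; (7) $\langle x,y\rangle z=x[y,z]$. $S$ and $T$ are strongly Morita equivalent if such a Morita context exists. $S_E$ (the idempotent splitting of $S$) is the category with object set $E(S)$ and arrows $(f,s,e)\colon e\to f$ with $e,f\in E(S)$, $s\in fSe$; composition is $(f,s,e)(e,s',d)=(f,ss',d)$ and the identity at $e$ is $(e,e,e)$. *)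

theory Defs
  imports Main "HOL-Algebra.Congruence"
begin

section \<open>Inverse semigroups\<close>

record 'a semigroup_struct = "'a partial_object" +
  sg_mult :: "'a \<Rightarrow> 'a \<Rightarrow> 'a" (infixl \<open>\<odot>\<index>\<close> 70)

locale inverse_semigroup =
  fixes S :: "('a, 'k) semigroup_struct_scheme" (structure)
  assumes mult_closed: "\<lbrakk>s \<in> carrier S; t \<in> carrier S\<rbrakk> \<Longrightarrow> s \<odot> t \<in> carrier S"
    and mult_assoc: "\<lbrakk>s \<in> carrier S; t \<in> carrier S; u \<in> carrier S\<rbrakk>
      \<Longrightarrow> (s \<odot> t) \<odot> u = s \<odot> (t \<odot> u)"
    and unique_inverse: "s \<in> carrier S
      \<Longrightarrow> \<exists>!t. t \<in> carrier S \<and> s \<odot> t \<odot> s = s \<and> t \<odot> s \<odot> t = t"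

definition star :: "('a, 'k) semigroup_struct_scheme \<Rightarrow> 'a \<Rightarrow> 'a" where
  "star S s = (THE t. t \<in> carrier S \<and> s \<odot>\<^bsub>S\<^esub> t \<odot>\<^bsub>S\<^esub> s = s \<and> t \<odot>\<^bsub>S\<^esub> s \<odot>\<^bsub>S\<^esub> t = t)"

definition idempotents :: "('a, 'k) semigroup_struct_scheme \<Rightarrow> 'a set" where
  "idempotents S = {e \<in> carrier S. e \<odot>\<^bsub>S\<^esub> e = e}"

section \<open>Strong Morita equivalence\<close>

locale morita_context =
  S: inverse_semigroup S + T: inverse_semigroup T
  for S :: "('a, 'k) semigroup_struct_scheme" and T :: "('b, 'l) semigroup_struct_scheme" +
  fixes X :: "'x set"
    and lact :: "'a \<Rightarrow> 'x \<Rightarrow> 'x"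
    and ract :: "'x \<Rightarrow> 'b \<Rightarrow> 'x"
    and angle :: "'x \<Rightarrow> 'x \<Rightarrow> 'a"
    and square :: "'x \<Rightarrow> 'x \<Rightarrow> 'b"
  assumes lact_closed: "\<lbrakk>s \<in> carrier S; x \<in> X\<rbrakk> \<Longrightarrow> lact s x \<in> X"
    and lact_mult: "\<lbrakk>s \<in> carrier S; s' \<in> carrier S; x \<in> X\<rbrakk>
      \<Longrightarrow> lact (s \<odot>\<^bsub>S\<^esub> s') x = lact s (lact s' x)"
    and ract_closed: "\<lbrakk>x \<in> X; t \<in> carrier T\<rbrakk> \<Longrightarrow> ract x t \<in> X"
    and ract_mult: "\<lbrakk>x \<in> X; t \<in> carrier T; t' \<in> carrier T\<rbrakk>
      \<Longrightarrow> ract x (t \<odot>\<^bsub>T\<^esub> t') = ract (ract x t) t'"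
    and act_commute: "\<lbrakk>s \<in> carrier S; x \<in> X; t \<in> carrier T\<rbrakk>
      \<Longrightarrow> ract (lact s x) t = lact s (ract x t)"
    and angle_surj: "(\<lambda>(x, y). angle x y) ` (X \<times> X) = carrier S"
    and square_surj: "(\<lambda>(x, y). square x y) ` (X \<times> X) = carrier T"
    and angle_lact: "\<lbrakk>s \<in> carrier S; x \<in> X; y \<in> X\<rbrakk>
      \<Longrightarrow> angle (lact s x) y = s \<odot>\<^bsub>S\<^esub> angle x y"
    and angle_star: "\<lbrakk>x \<in> X; y \<in> X\<rbrakk> \<Longrightarrow> angle y x = star S (angle x y)"
    and angle_self: "x \<in> X \<Longrightarrow> lact (angle x x) x = x"
    and square_ract: "\<lbrakk>x \<in> X; y \<in> X; t \<in> carrier T\<rbrakk>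
      \<Longrightarrow> square x (ract y t) = square x y \<odot>\<^bsub>T\<^esub> t"
    and square_star: "\<lbrakk>x \<in> X; y \<in> X\<rbrakk> \<Longrightarrow> square y x = star T (square x y)"
    and square_self: "x \<in> X \<Longrightarrow> ract x (square x x) = x"
    and angle_square: "\<lbrakk>x \<in> X; y \<in> X; z \<in> X\<rbrakk>
      \<Longrightarrow> lact (angle x y) z = ract x (square y z)"

text \<open>HOL cannot quantify over types inside a formula, so the type of the elements of the set
  \<open>X\<close> is a parameter. A theorem assuming this predicate for a free type variable \<open>'x\<close>
  covers Morita contexts whose set \<open>X\<close> lives in any type.\<close>

definition strongly_morita_equivalent ::
  "'x itself \<Rightarrow> ('a, 'k) semigroup_struct_scheme \<Rightarrow> ('b, 'l) semigroup_struct_scheme \<Rightarrow> bool" where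
  "strongly_morita_equivalent (_ :: 'x itself) S T \<longleftrightarrow>
    (\<exists>(X :: 'x set) lact ract angle square. morita_context S T X lact ract angle square)"

section \<open>Categories, functors and equivalences\<close>

text \<open>All operations are total functions; only their values on objects, on arrows and on
  composable pairs are meaningful. \<open>Comp C g f\<close> is \<open>g\<close> after \<open>f\<close>.\<close>

record ('o, 'm) cat_struct =
  Ob :: "'o set"
  Arr :: "'m set"
  Dom :: "'m \<Rightarrow> 'o"
  Cod :: "'m \<Rightarrow> 'o"
  Id :: "'o \<Rightarrow> 'm"
  Comp :: "'m \<Rightarrow> 'm \<Rightarrow> 'm"

locale category =
  fixes C :: "('o, 'm) cat_struct"
  assumes dom_ob: "f \<in> Arr C \<Longrightarrow> Dom C f \<in> Ob C"
    and cod_ob: "f \<in> Arr C \<Longrightarrow> Cod C f \<in> Ob C"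
    and id_arr: "a \<in> Ob C \<Longrightarrow> Id C a \<in> Arr C"
    and id_dom: "a \<in> Ob C \<Longrightarrow> Dom C (Id C a) = a"
    and id_cod: "a \<in> Ob C \<Longrightarrow> Cod C (Id C a) = a"
    and comp_arr: "\<lbrakk>f \<in> Arr C; g \<in> Arr C; Dom C g = Cod C f\<rbrakk> \<Longrightarrow> Comp C g f \<in> Arr C"
    and comp_dom: "\<lbrakk>f \<in> Arr C; g \<in> Arr C; Dom C g = Cod C f\<rbrakk> \<Longrightarrow> Dom C (Comp C g f) = Dom C f"
    and comp_cod: "\<lbrakk>f \<in> Arr C; g \<in> Arr C; Dom C g = Cod C f\<rbrakk> \<Longrightarrow> Cod C (Comp C g f) = Cod C g"
    and comp_assoc: "\<lbrakk>f \<in> Arr C; g \<in> Arr C; h \<in> Arr C; Dom C g = Cod C f; Dom C h = Cod C g\<rbrakk>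
      \<Longrightarrow> Comp C (Comp C h g) f = Comp C h (Comp C g f)"
    and id_left: "f \<in> Arr C \<Longrightarrow> Comp C (Id C (Cod C f)) f = f"
    and id_right: "f \<in> Arr C \<Longrightarrow> Comp C f (Id C (Dom C f)) = f"

definition iso_arrow :: "('o, 'm) cat_struct \<Rightarrow> 'm \<Rightarrow> bool" where
  "iso_arrow C f \<longleftrightarrow> f \<in> Arr C \<and>
    (\<exists>g \<in> Arr C. Dom C g = Cod C f \<and> Cod C g = Dom C f \<and>
      Comp C g f = Id C (Dom C f) \<and> Comp C f g = Id C (Cod C f))"

record ('o1, 'm1, 'o2, 'm2) functor_struct =
  on_ob :: "'o1 \<Rightarrow> 'o2"
  on_arr :: "'m1 \<Rightarrow> 'm2"

locale cat_functor = C: category C + D: category D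
  for C :: "('o1, 'm1) cat_struct" and D :: "('o2, 'm2) cat_struct" +
  fixes F :: "('o1, 'm1, 'o2, 'm2) functor_struct"
  assumes map_ob: "a \<in> Ob C \<Longrightarrow> on_ob F a \<in> Ob D"
    and map_arr: "f \<in> Arr C \<Longrightarrow> on_arr F f \<in> Arr D"
    and map_dom: "f \<in> Arr C \<Longrightarrow> Dom D (on_arr F f) = on_ob F (Dom C f)"
    and map_cod: "f \<in> Arr C \<Longrightarrow> Cod D (on_arr F f) = on_ob F (Cod C f)"
    and map_id: "a \<in> Ob C \<Longrightarrow> on_arr F (Id C a) = Id D (on_ob F a)"
    and map_comp: "\<lbrakk>f \<in> Arr C; g \<in> Arr C; Dom C g = Cod C f\<rbrakk>
      \<Longrightarrow> on_arr F (Comp C g f) = Comp D (on_arr F g) (on_arr F f)"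

definition id_functor :: "('o, 'm, 'o, 'm) functor_struct" where
  "id_functor = \<lparr>on_ob = (\<lambda>a. a), on_arr = (\<lambda>f. f)\<rparr>"

definition comp_functor ::
  "('o2, 'm2, 'o3, 'm3) functor_struct \<Rightarrow> ('o1, 'm1, 'o2, 'm2) functor_struct
    \<Rightarrow> ('o1, 'm1, 'o3, 'm3) functor_struct" where
  "comp_functor G F = \<lparr>on_ob = on_ob G \<circ> on_ob F, on_arr = on_arr G \<circ> on_arr F\<rparr>"

locale natural_isomorphism = F: cat_functor C D F + G: cat_functor C D G
  for C :: "('o1, 'm1) cat_struct" and D :: "('o2, 'm2) cat_struct"
    and F :: "('o1, 'm1, 'o2, 'm2) functor_struct"
    and G :: "('o1, 'm1, 'o2, 'm2) functor_struct" +
  fixes \<tau> :: "'o1 \<Rightarrow> 'm2"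
  assumes component_iso: "a \<in> Ob C \<Longrightarrow> iso_arrow D (\<tau> a)"
    and component_dom: "a \<in> Ob C \<Longrightarrow> Dom D (\<tau> a) = on_ob F a"
    and component_cod: "a \<in> Ob C \<Longrightarrow> Cod D (\<tau> a) = on_ob G a"
    and naturality: "f \<in> Arr C
      \<Longrightarrow> Comp D (on_arr G f) (\<tau> (Dom C f)) = Comp D (\<tau> (Cod C f)) (on_arr F f)"

definition equivalence_of_categories ::
  "('o1, 'm1) cat_struct \<Rightarrow> ('o2, 'm2) cat_struct \<Rightarrow> ('o1, 'm1, 'o2, 'm2) functor_struct \<Rightarrow> bool"
where
  "equivalence_of_categories C D F \<longleftrightarrow> cat_functor C D F \<and>
    (\<exists>G. cat_functor D C G \<and>
      (\<exists>\<eta>. natural_isomorphism C C id_functor (comp_functor G F) \<eta>) \<and>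
      (\<exists>\<epsilon>. natural_isomorphism D D (comp_functor F G) id_functor \<epsilon>))"

section \<open>The idempotent splitting\<close>

text \<open>An arrow \<open>(f, s, e)\<close> goes from its third component \<open>e\<close> to its first component \<open>f\<close>.\<close>

definition idempotent_splitting ::
  "('a, 'k) semigroup_struct_scheme \<Rightarrow> ('a, 'a \<times> 'a \<times> 'a) cat_struct" where
  "idempotent_splitting S =
    \<lparr>Ob = idempotents S,
     Arr = {(f, s, e). f \<in> idempotents S \<and> e \<in> idempotents S \<and>
              s \<in> {f \<odot>\<^bsub>S\<^esub> a \<odot>\<^bsub>S\<^esub> e | a. a \<in> carrier S}},
     Dom = (\<lambda>(f, s, e). e),
     Cod = (\<lambda>(f, s, e). f),
     Id = (\<lambda>e. (e, e, e)),
     Comp = (\<lambda>(f, s, e) (e', s', d). (f, s \<odot>\<^bsub>S\<^esub> s', d))\<rparr>"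

end

theory Submission
  imports Defs
begin

text \<open>In a Morita context every idempotent \<open>e\<close> of \<open>S\<close> has the form \<open>\<langle>p e, p e\<rangle>\<close>. Choosing such
  points \<open>p e\<close>, one sets \<open>F e = [p e, p e]\<close> and sends \<open>s : e \<rightarrow> f\<close> to \<open>[p f, s (p e)]\<close>. Turning the
  two actions around with the help of the involutions makes \<open>X\<close> a Morita context for \<open>(T, S)\<close>, so
  the same recipe, with points \<open>q g\<close>, gives a functor \<open>G\<close> backwards. With \<open>x = p e\<close> and \<open>y = q (F e)\<close>
  we have \<open>[x, x] = [y, y]\<close>, and \<open>\<langle>y, x\<rangle> : e \<rightarrow> G (F e)\<close> is a natural isomorphism with inverse
  \<open>\<langle>x, y\<rangle>\<close>. The other natural isomorphism is the inverse of the corresponding one for \<open>(T, S)\<close>.\<close>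

section \<open>Inverse semigroups\<close>

lemma splitting_simps [simp]:
  "Ob (idempotent_splitting S) = idempotents S"
  "Dom (idempotent_splitting S) (f, s, e) = e"
  "Cod (idempotent_splitting S) (f, s, e) = f"
  "Id (idempotent_splitting S) e = (e, e, e)"
  "Comp (idempotent_splitting S) (f, s, e) (e', s', d) = (f, s \<odot>\<^bsub>S\<^esub> s', d)"
  by (simp_all add: idempotent_splitting_def)

context inverse_semigroup
begin

section \<open>Inverses and products of idempotents\<close>

lemma star_props:
  assumes "s \<in> carrier S"
  shows star_closed: "star S s \<in> carrier S"
    and mult_star_mult: "s \<odot> star S s \<odot> s = s"
    and star_mult_star: "star S s \<odot> s \<odot> star S s = star S s"
  using theI'[OF unique_inverse[OF assms]] unfolding star_def by auto

lemma star_eqI: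
  assumes "s \<in> carrier S" "t \<in> carrier S" "s \<odot> t \<odot> s = s" "t \<odot> s \<odot> t = t"
  shows "star S s = t"
  unfolding star_def by (rule the1_equality[OF unique_inverse]) (use assms in auto)

lemma star_star: "s \<in> carrier S \<Longrightarrow> star S (star S s) = s"
  by (rule star_eqI) (auto simp: star_props)

lemma star_idem: "\<lbrakk>e \<in> carrier S; e \<odot> e = e\<rbrakk> \<Longrightarrow> star S e = e"
  by (rule star_eqI) auto

text \<open>An idempotent is its own inverse, so it suffices that the inverse \<open>x\<close> of
  \<open>e \<odot> f\<close> is idempotent: then \<open>e \<odot> f = star S x = x\<close>.\<close>

lemma idem_mult_idem:
  assumes e: "e \<in> carrier S" "e \<odot> e = e" and f: "f \<in> carrier S" "f \<odot> f = f"
  shows "(e \<odot> f) \<odot> (e \<odot> f) = e \<odot> f"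
proof -
  define x where "x = star S (e \<odot> f)"
  have xc: "x \<in> carrier S"
    and x1: "e \<odot> f \<odot> x \<odot> (e \<odot> f) = e \<odot> f"
    and x2: "x \<odot> (e \<odot> f) \<odot> x = x"
    unfolding x_def using e f by (simp_all add: star_props mult_closed)
  note cl = e(1) f(1) xc mult_closed
  have ee: "e \<odot> (e \<odot> u) = e \<odot> u" if "u \<in> carrier S" for u
    using mult_assoc[of e e u] e that by simp
  have ff: "f \<odot> (f \<odot> u) = f \<odot> u" if "u \<in> carrier S" for u
    using mult_assoc[of f f u] f that by simp
  have x1': "e \<odot> (f \<odot> (x \<odot> (e \<odot> f))) = e \<odot> f"
    using x1 by (simp add: mult_assoc cl)
  have x2': "x \<odot> (e \<odot> (f \<odot> x)) = x"
    using x2 by (simp add: mult_assoc cl)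
  have x2'': "x \<odot> (e \<odot> (f \<odot> (x \<odot> u))) = x \<odot> u" if "u \<in> carrier S" for u
    using arg_cong[OF x2', of "\<lambda>v. v \<odot> u"] that by (simp add: mult_assoc cl)
  \<comment> \<open>\<open>f x e\<close> is idempotent and is also an inverse of \<open>e f\<close>, so it equals \<open>x\<close>.\<close>
  have "x = f \<odot> x \<odot> e"
    unfolding x_def
  proof (rule star_eqI, fold x_def)
    show "e \<odot> f \<odot> (f \<odot> x \<odot> e) \<odot> (e \<odot> f) = e \<odot> f"
      by (simp add: mult_assoc cl ee ff x1')
    show "f \<odot> x \<odot> e \<odot> (e \<odot> f) \<odot> (f \<odot> x \<odot> e) = f \<odot> x \<odot> e"
      by (simp add: mult_assoc cl ee ff x2'')
  qed (simp_all add: cl)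
  moreover have "(f \<odot> x \<odot> e) \<odot> (f \<odot> x \<odot> e) = f \<odot> x \<odot> e"
    by (simp add: mult_assoc cl x2'')
  ultimately have xx: "x \<odot> x = x" by simp
  have "star S x = x" using xc xx by (rule star_idem)
  moreover have "star S x = e \<odot> f" unfolding x_def by (rule star_star) (simp add: cl)
  ultimately show ?thesis using xx by simp
qed

text \<open>As both products are idempotent, \<open>f \<odot> e\<close> and
  \<open>e \<odot> f\<close> are each an inverse of \<open>e \<odot> f\<close>; uniqueness
  identifies them.\<close>

lemma idem_commute:
  assumes e: "e \<in> carrier S" "e \<odot> e = e" and f: "f \<in> carrier S" "f \<odot> f = f"
  shows "e \<odot> f = f \<odot> e"
proof -
  have ef: "(e \<odot> f) \<odot> (e \<odot> f) = e \<odot> f" and fe: "(f \<odot> e) \<odot> (f \<odot> e) = f \<odot> e"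
    using e f by (simp_all add: idem_mult_idem)
  note cl = e(1) f(1) mult_closed
  have ee: "e \<odot> (e \<odot> u) = e \<odot> u" if "u \<in> carrier S" for u
    using mult_assoc[of e e u] e that by simp
  have ff: "f \<odot> (f \<odot> u) = f \<odot> u" if "u \<in> carrier S" for u
    using mult_assoc[of f f u] f that by simp
  have "star S (e \<odot> f) = f \<odot> e"
    by (rule star_eqI) (use ef fe in \<open>simp_all add: mult_assoc cl ee ff\<close>)
  moreover have "star S (e \<odot> f) = e \<odot> f"
    by (rule star_idem) (use ef in \<open>simp_all add: cl\<close>)
  ultimately show ?thesis by simp
qed

text \<open>The idempotents \<open>star S s \<odot> s\<close> and \<open>t \<odot> star S t\<close>
  commute; exchanging them splits each inverse law for \<open>s \<odot> t\<close> into the laws for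
  \<open>s\<close> and for \<open>t\<close>.\<close>

lemma star_mult:
  assumes s: "s \<in> carrier S" and t: "t \<in> carrier S"
  shows "star S (s \<odot> t) = star S t \<odot> star S s"
proof -
  note cl = s t star_closed[OF s] star_closed[OF t] mult_closed
  have comm: "(star S s \<odot> s) \<odot> (t \<odot> star S t) = (t \<odot> star S t) \<odot> (star S s \<odot> s)"
    by (rule idem_commute)
      (simp_all add: cl mult_assoc[symmetric] mult_star_mult star_mult_star)
  have "s \<odot> t \<odot> (star S t \<odot> star S s) \<odot> (s \<odot> t)
      = s \<odot> ((t \<odot> star S t) \<odot> (star S s \<odot> s)) \<odot> t"
    by (simp add: mult_assoc cl)
  also have "\<dots> = (s \<odot> star S s \<odot> s) \<odot> (t \<odot> star S t \<odot> t)"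
    unfolding comm[symmetric] by (simp add: mult_assoc cl)
  finally have 1: "s \<odot> t \<odot> (star S t \<odot> star S s) \<odot> (s \<odot> t) = s \<odot> t"
    by (simp only: mult_star_mult s t)
  have "star S t \<odot> star S s \<odot> (s \<odot> t) \<odot> (star S t \<odot> star S s)
      = star S t \<odot> ((star S s \<odot> s) \<odot> (t \<odot> star S t)) \<odot> star S s"
    by (simp add: mult_assoc cl)
  also have "\<dots> = (star S t \<odot> t \<odot> star S t) \<odot> (star S s \<odot> s \<odot> star S s)"
    unfolding comm by (simp add: mult_assoc cl)
  finally have 2: "star S t \<odot> star S s \<odot> (s \<odot> t) \<odot> (star S t \<odot> star S s) = star S t \<odot> star S s"
    by (simp only: star_mult_star s t)
  show ?thesis by (rule star_eqI) (use 1 2 in \<open>simp_all add: cl\<close>)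
qed

text \<open>Absorption on both sides replaces the existential form of \<open>fSe\<close>: an
  absorbing \<open>s\<close> equals \<open>f \<odot> s \<odot> e\<close>, so it is its own
  witness.\<close>

lemma splitting_arr_iff:
  "(f, s, e) \<in> Arr (idempotent_splitting S) \<longleftrightarrow>
    f \<in> idempotents S \<and> e \<in> idempotents S \<and> s \<in> carrier S \<and> f \<odot> s = s \<and> s \<odot> e = s"
proof -
  have "f \<odot> s = s \<and> s \<odot> e = s \<and> s \<in> carrier S"
    if "f \<in> idempotents S" "e \<in> idempotents S" "a \<in> carrier S" "s = f \<odot> a \<odot> e" for a
    using that mult_assoc[of f f "a \<odot> e"] by (auto simp: idempotents_def mult_assoc mult_closed)
  moreover have "\<exists>a. s = f \<odot> a \<odot> e \<and> a \<in> carrier S"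
    if "s \<in> carrier S" "f \<odot> s = s" "s \<odot> e = s"
    using that by (intro exI[of _ s]) simp
  ultimately show ?thesis
    unfolding idempotent_splitting_def by auto
qed

lemma category_splitting: "category (idempotent_splitting S)"
  by unfold_locales
    (auto simp: splitting_arr_iff mult_closed idempotents_def mult_assoc, metis mult_assoc)

end

section \<open>Functors and natural isomorphisms\<close>

lemma cat_functor_id: "category C \<Longrightarrow> cat_functor C C id_functor"
  by (simp add: cat_functor_def cat_functor_axioms_def id_functor_def)

lemma cat_functor_comp:
  assumes "cat_functor C D F" "cat_functor D E G"
  shows "cat_functor C E (comp_functor G F)"
proof -
  interpret F: cat_functor C D F by fact
  interpret G: cat_functor D E G by fact
  show ?thesis
    by unfold_locales
      (simp_all add: comp_functor_def F.map_ob F.map_arr F.map_dom F.map_cod F.map_id F.map_comp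
        G.map_ob G.map_arr G.map_dom G.map_cod G.map_id G.map_comp)
qed

text \<open>The inverses of the components work: composing the old naturality square with them on
  both sides gives the new one.\<close>

lemma natural_isomorphism_sym:
  assumes "natural_isomorphism C D F G \<tau>"
  shows "\<exists>\<sigma>. natural_isomorphism C D G F \<sigma>"
proof -
  interpret natural_isomorphism C D F G \<tau> by fact
  have "\<exists>g. g \<in> Arr D \<and> Dom D g = on_ob G a \<and> Cod D g = on_ob F a \<and>
      Comp D g (\<tau> a) = Id D (on_ob F a) \<and> Comp D (\<tau> a) g = Id D (on_ob G a)"
    if "a \<in> Ob C" for a
    using component_iso[OF that] component_dom[OF that] component_cod[OF that]
    unfolding iso_arrow_def by auto
  then obtain \<sigma> where \<sigma>: "\<And>a. a \<in> Ob C \<Longrightarrow> \<sigma> a \<in> Arr D"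
      "\<And>a. a \<in> Ob C \<Longrightarrow> Dom D (\<sigma> a) = on_ob G a"
      "\<And>a. a \<in> Ob C \<Longrightarrow> Cod D (\<sigma> a) = on_ob F a"
      "\<And>a. a \<in> Ob C \<Longrightarrow> Comp D (\<sigma> a) (\<tau> a) = Id D (on_ob F a)"
      "\<And>a. a \<in> Ob C \<Longrightarrow> Comp D (\<tau> a) (\<sigma> a) = Id D (on_ob G a)"
    by metis
  have \<tau>: "\<tau> a \<in> Arr D" if "a \<in> Ob C" for a
    using component_iso[OF that] by (simp add: iso_arrow_def)
  have "natural_isomorphism C D G F \<sigma>"
  proof unfold_locales
    fix a assume a: "a \<in> Ob C"
    show "iso_arrow D (\<sigma> a)"
      unfolding iso_arrow_def
      using a \<sigma> \<tau> component_dom component_cod by (intro conjI bexI[of _ "\<tau> a"]) simp_all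
    show "Dom D (\<sigma> a) = on_ob G a" "Cod D (\<sigma> a) = on_ob F a" using a \<sigma> by simp_all
  next
    fix f assume f: "f \<in> Arr C"
    let ?a = "Dom C f" and ?b = "Cod C f"
    have ob: "?a \<in> Ob C" "?b \<in> Ob C" using f by (simp_all add: F.C.dom_ob F.C.cod_ob)
    note facts = f ob \<sigma>(1-3) \<tau> component_dom component_cod F.map_arr F.map_dom F.map_cod
      G.map_arr G.map_dom G.map_cod F.D.comp_arr F.D.comp_dom F.D.comp_cod
    have "Comp D (on_arr F f) (\<sigma> ?a)
        = Comp D (Comp D (Comp D (\<sigma> ?b) (\<tau> ?b)) (on_arr F f)) (\<sigma> ?a)"
      using F.D.id_left[of "on_arr F f"] by (simp add: \<sigma>(4) facts)
    also have "\<dots> = Comp D (\<sigma> ?b) (Comp D (Comp D (\<tau> ?b) (on_arr F f)) (\<sigma> ?a))"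
      by (simp add: F.D.comp_assoc facts)
    also have "\<dots> = Comp D (\<sigma> ?b) (Comp D (Comp D (on_arr G f) (\<tau> ?a)) (\<sigma> ?a))"
      by (simp add: naturality f)
    also have "\<dots> = Comp D (\<sigma> ?b) (Comp D (on_arr G f) (Comp D (\<tau> ?a) (\<sigma> ?a)))"
      by (simp add: F.D.comp_assoc facts)
    also have "\<dots> = Comp D (\<sigma> ?b) (on_arr G f)"
      using F.D.id_right[of "on_arr G f"] by (simp add: \<sigma>(5) facts)
    finally show "Comp D (on_arr F f) (\<sigma> (Dom C f)) = Comp D (\<sigma> (Cod C f)) (on_arr G f)" .
  qed
  then show ?thesis by blast
qed

text \<open>Functors are total functions, so they can agree on objects and arrows without being
  equal. This is used to remove a double \<open>star\<close>, which is trivial only on the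
  carrier.\<close>

lemma natural_isomorphism_cong:
  assumes "natural_isomorphism C D F G \<tau>" "cat_functor C D G'"
    and "\<And>a. a \<in> Ob C \<Longrightarrow> on_ob G' a = on_ob G a"
    and "\<And>f. f \<in> Arr C \<Longrightarrow> on_arr G' f = on_arr G f"
  shows "natural_isomorphism C D F G' \<tau>"
proof -
  interpret natural_isomorphism C D F G \<tau> by fact
  interpret G': cat_functor C D G' by fact
  show ?thesis
    by unfold_locales (simp_all add: assms component_iso component_dom component_cod naturality)
qed

section \<open>Morita contexts\<close>

text \<open>Neither the context nor the choice \<open>p\<close> of points is fixed, so the swapped
  context yields the backward functor from the same definition.\<close>

definition morita_functor ::
  "('a \<Rightarrow> 'x \<Rightarrow> 'x) \<Rightarrow> ('x \<Rightarrow> 'x \<Rightarrow> 'b) \<Rightarrow> ('a \<Rightarrow> 'x)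
    \<Rightarrow> ('a, 'a \<times> 'a \<times> 'a, 'b, 'b \<times> 'b \<times> 'b) functor_struct" where
  "morita_functor lact square p =
    \<lparr>on_ob = (\<lambda>e. square (p e) (p e)),
     on_arr = (\<lambda>(f, s, e). (square (p f) (p f), square (p f) (lact s (p e)), square (p e) (p e)))\<rparr>"

lemma morita_functor_simps [simp]:
  "on_ob (morita_functor lact square p) e = square (p e) (p e)"
  "on_arr (morita_functor lact square p) (f, s, e) =
    (square (p f) (p f), square (p f) (lact s (p e)), square (p e) (p e))"
  by (simp_all add: morita_functor_def)

context morita_context
begin

section \<open>Calculus of the two brackets\<close>

lemma angle_closed: "\<lbrakk>x \<in> X; y \<in> X\<rbrakk> \<Longrightarrow> angle x y \<in> carrier S"
  using angle_surj by force

lemma square_closed: "\<lbrakk>x \<in> X; y \<in> X\<rbrakk> \<Longrightarrow> square x y \<in> carrier T"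
  using square_surj by force

text \<open>As for a Hermitian form, linearity on one side and symmetry up to \<open>star\<close>
  give conjugate linearity on the other.\<close>

lemma angle_lact_right:
  assumes "s \<in> carrier S" "x \<in> X" "y \<in> X"
  shows "angle x (lact s y) = angle x y \<odot>\<^bsub>S\<^esub> star S s"
  using assms angle_star[of "lact s y" x] angle_star[of y x]
  by (simp add: lact_closed angle_lact S.star_mult angle_closed)

lemma square_ract_left:
  assumes "t \<in> carrier T" "x \<in> X" "y \<in> X"
  shows "square (ract x t) y = star T t \<odot>\<^bsub>T\<^esub> square x y"
  using assms square_star[of y "ract x t"] square_star[of y x]
  by (simp add: ract_closed square_ract T.star_mult square_closed)

text \<open>Since \<open>star\<close> reverses products, it turns the right action into a left one
  and conversely, while the brackets trade places.\<close>

lemma swapped: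
  "morita_context T S X (\<lambda>t x. ract x (star T t)) (\<lambda>x s. lact (star S s) x) square angle"
proof unfold_locales
  fix x y z assume xyz: "x \<in> X" "y \<in> X" "z \<in> X"
  show "ract z (star T (square x y)) = lact (star S (angle y z)) x"
    using xyz angle_square[of z y x] by (simp flip: angle_star square_star)
qed (simp_all add: S.star_closed T.star_closed lact_closed ract_closed S.star_mult T.star_mult
    S.star_star T.star_star lact_mult ract_mult act_commute angle_surj square_surj
    angle_lact_right square_ract_left angle_self square_self flip: angle_star square_star)

text \<open>The second bracket moves into the first as a right action on \<open>y\<close>, which
  \<open>angle_square\<close> converts into a left action on \<open>w\<close>. Products in
  \<open>T\<close> thus become computations in \<open>S\<close>.\<close>

lemma square_mult:
  assumes "x \<in> X" "y \<in> X" "z \<in> X" "w \<in> X"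
  shows "square x y \<odot>\<^bsub>T\<^esub> square z w = square x (lact (angle y z) w)"
  using assms by (simp add: angle_square square_ract square_closed)

lemma square_self_mult: "\<lbrakk>x \<in> X; y \<in> X\<rbrakk> \<Longrightarrow> square x x \<odot>\<^bsub>T\<^esub> square x y = square x y"
  using square_ract_left[of "square x x" x y] square_star[of x x]
  by (simp add: square_self square_closed)

lemma square_mult_self: "\<lbrakk>x \<in> X; y \<in> X\<rbrakk> \<Longrightarrow> square x y \<odot>\<^bsub>T\<^esub> square y y = square x y"
  using square_ract[of x y "square y y"] by (simp add: square_self square_closed)

lemma square_idem: "x \<in> X \<Longrightarrow> square x x \<in> idempotents T"
  by (simp add: idempotents_def square_closed square_self_mult)

lemma angle_mult:
  assumes "x \<in> X" "y \<in> X" "z \<in> X" "w \<in> X"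
  shows "angle x y \<odot>\<^bsub>S\<^esub> angle z w = angle (ract x (square y z)) w"
  using assms by (simp add: angle_lact angle_closed flip: angle_square)

lemma idem_eq_angle_self:
  assumes "e \<in> idempotents S"
  shows "\<exists>z \<in> X. angle z z = e"
proof -
  have e: "e \<in> carrier S" "e \<odot>\<^bsub>S\<^esub> e = e" using assms by (auto simp: idempotents_def)
  from e(1) obtain x y where xy: "x \<in> X" "y \<in> X" "e = angle x y"
    unfolding angle_surj[symmetric] by auto
  \<comment> \<open>The point \<open>e x\<close> works: \<open>\<langle>e x, e x\<rangle> = e \<langle>x, x\<rangle> e\<close>, and \<open>\<langle>x, x\<rangle>\<close> fixes \<open>e = \<langle>x, y\<rangle>\<close>.\<close>
  have "angle x x \<odot>\<^bsub>S\<^esub> e = e"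
    using xy angle_lact[of "angle x x" x y] by (simp add: angle_self angle_closed)
  then have "angle (lact e x) (lact e x) = e"
    using e xy(1) by (simp add: angle_lact angle_lact_right lact_closed S.star_idem S.mult_assoc
        angle_closed)
  then show ?thesis using e xy lact_closed by blast
qed

text \<open>Identities are preserved because \<open>e = angle (p e) (p e)\<close> fixes
  \<open>p e\<close>; composites because the two inner points contribute a factor \<open>e\<close>,
  which \<open>s\<close> absorbs.\<close>

lemma morita_functor:
  assumes p: "\<And>e. e \<in> idempotents S \<Longrightarrow> p e \<in> X"
    and pp: "\<And>e. e \<in> idempotents S \<Longrightarrow> angle (p e) (p e) = e"
  shows "cat_functor (idempotent_splitting S) (idempotent_splitting T)
    (morita_functor lact square p)"
proof -
  interpret CS: category "idempotent_splitting S" by (rule S.category_splitting)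
  interpret CT: category "idempotent_splitting T" by (rule T.category_splitting)
  show ?thesis
  proof unfold_locales
    fix a assume a: "a \<in> Ob (idempotent_splitting S)"
    then show "on_ob (morita_functor lact square p) a \<in> Ob (idempotent_splitting T)"
      by (simp add: p square_idem)
    show "on_arr (morita_functor lact square p) (Id (idempotent_splitting S) a) =
        Id (idempotent_splitting T) (on_ob (morita_functor lact square p) a)"
      using a angle_self[OF p, of a] by (simp add: pp)
  next
    fix u assume u: "u \<in> Arr (idempotent_splitting S)"
    obtain f s e where u_eq: "u = (f, s, e)" by (cases u)
    have s: "f \<in> idempotents S" "e \<in> idempotents S" "s \<in> carrier S"
      using u by (auto simp: u_eq S.splitting_arr_iff)
    \<comment> \<open>The actions commute, so the right factor reaches \<open>p e\<close> and fixes
      it.\<close>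
    have "square (p f) (lact s (p e)) \<odot>\<^bsub>T\<^esub> square (p e) (p e) = square (p f) (lact s (p e))"
      using s by (simp add: p lact_closed square_closed act_commute square_self flip: square_ract)
    then show "on_arr (morita_functor lact square p) u \<in> Arr (idempotent_splitting T)"
      using s by (simp add: u_eq T.splitting_arr_iff p lact_closed square_closed square_idem
          square_self_mult)
    show "Dom (idempotent_splitting T) (on_arr (morita_functor lact square p) u) =
        on_ob (morita_functor lact square p) (Dom (idempotent_splitting S) u)"
      and "Cod (idempotent_splitting T) (on_arr (morita_functor lact square p) u) =
        on_ob (morita_functor lact square p) (Cod (idempotent_splitting S) u)"
      by (simp_all add: u_eq)
  next
    fix u v assume uv: "u \<in> Arr (idempotent_splitting S)" "v \<in> Arr (idempotent_splitting S)"
      "Dom (idempotent_splitting S) v = Cod (idempotent_splitting S) u"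
    obtain e s d where u: "u = (e, s, d)" by (cases u)
    obtain f t where v: "v = (f, t, e)" using uv(3) by (cases v) (simp add: u)
    have st: "d \<in> idempotents S" "e \<in> idempotents S" "f \<in> idempotents S"
      "e \<in> carrier S" "s \<in> carrier S" "t \<in> carrier S" "e \<odot>\<^bsub>S\<^esub> s = s"
      using uv by (auto simp: u v S.splitting_arr_iff idempotents_def)
    have "square (p f) (lact t (p e)) \<odot>\<^bsub>T\<^esub> square (p e) (lact s (p d))
        = square (p f) (lact t (lact (angle (p e) (p e)) (lact s (p d))))"
      using st by (simp add: p lact_closed square_mult angle_lact angle_closed lact_mult)
    also have "\<dots> = square (p f) (lact (t \<odot>\<^bsub>S\<^esub> s) (p d))"
      using st lact_mult[of e s "p d"] by (simp add: pp p lact_mult)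
    finally show "on_arr (morita_functor lact square p) (Comp (idempotent_splitting S) v u) =
        Comp (idempotent_splitting T) (on_arr (morita_functor lact square p) v)
          (on_arr (morita_functor lact square p) u)"
      by (simp add: u v)
  qed
qed

lemma unit_natural_isomorphism:
  assumes p: "\<And>e. e \<in> idempotents S \<Longrightarrow> p e \<in> X"
    and pp: "\<And>e. e \<in> idempotents S \<Longrightarrow> angle (p e) (p e) = e"
    and q: "\<And>g. g \<in> idempotents T \<Longrightarrow> q g \<in> X"
    and qq: "\<And>g. g \<in> idempotents T \<Longrightarrow> square (q g) (q g) = g"
  shows "\<exists>\<eta>. natural_isomorphism (idempotent_splitting S) (idempotent_splitting S) id_functor
    (comp_functor (morita_functor (\<lambda>t x. ract x (star T t)) angle q)
      (morita_functor lact square p)) \<eta>"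
proof -
  interpret sw: morita_context T S X "\<lambda>t x. ract x (star T t)" "\<lambda>x s. lact (star S s) x" square angle
    by (rule swapped)
  let ?S = "idempotent_splitting S"
  let ?GF = "comp_functor (morita_functor (\<lambda>t x. ract x (star T t)) angle q)
      (morita_functor lact square p)"
  interpret I: cat_functor ?S ?S id_functor
    by (intro cat_functor_id S.category_splitting)
  interpret GF: cat_functor ?S ?S ?GF
    by (rule cat_functor_comp[OF morita_functor[OF p pp] sw.morita_functor[OF q qq]])
  \<comment> \<open>The points \<open>x\<close> and \<open>y\<close> of the outline are
    \<open>p e\<close> and \<open>r e\<close>.\<close>
  define r where "r e = q (square (p e) (p e))" for e
  have r: "r e \<in> X" and rr: "square (r e) (r e) = square (p e) (p e)" if "e \<in> idempotents S" for e
    unfolding r_def using that by (simp_all add: p q qq square_idem)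
  \<comment> \<open>The inner bracket of each product is
    \<open>square (p e) (p e) = square (r e) (r e)\<close>, which fixes both points from the
    right.\<close>
  have rp: "angle (r e) (p e) \<odot>\<^bsub>S\<^esub> angle (p e) (r e) = angle (r e) (r e)"
    and pr: "angle (p e) (r e) \<odot>\<^bsub>S\<^esub> angle (r e) (p e) = e"
    if e: "e \<in> idempotents S" for e
    using p[OF e] r[OF e] square_self[of "p e"] square_self[of "r e"]
    by (simp_all add: angle_mult pp[OF e] rr[OF e])
  define \<eta> where "\<eta> e = (angle (r e) (r e), angle (r e) (p e), e)" for e
  define \<theta> where "\<theta> e = (e, angle (p e) (r e), angle (r e) (r e))" for e
  have \<eta>: "\<eta> e \<in> Arr ?S" and \<theta>: "\<theta> e \<in> Arr ?S" if e: "e \<in> idempotents S" for e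
    \<comment> \<open>In the swapped context \<open>angle\<close> plays the role of
      \<open>square\<close>, so these are absorption laws for \<open>angle\<close>.\<close>
    using e r[OF e] p[OF e] pp[OF e] sw.square_mult_self[of "r e" "p e"]
      sw.square_self_mult[of "p e" "r e"]
    by (simp_all add: \<eta>_def \<theta>_def S.splitting_arr_iff sw.square_idem angle_closed
        sw.square_self_mult sw.square_mult_self)
  have ob: "on_ob ?GF e = angle (r e) (r e)" for e
    by (simp add: comp_functor_def r_def)
  have "natural_isomorphism ?S ?S id_functor ?GF \<eta>"
  proof unfold_locales
    fix e assume "e \<in> Ob ?S"
    then have e: "e \<in> idempotents S" by simp
    show "iso_arrow ?S (\<eta> e)"
      unfolding iso_arrow_def using \<eta>[OF e] \<theta>[OF e]
      by (intro conjI bexI[of _ "\<theta> e"]) (simp_all add: \<eta>_def \<theta>_def rp[OF e] pr[OF e])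
    show "Dom ?S (\<eta> e) = on_ob id_functor e" by (simp add: \<eta>_def id_functor_def)
    show "Cod ?S (\<eta> e) = on_ob ?GF e" unfolding ob by (simp add: \<eta>_def)
  next
    fix u assume u: "u \<in> Arr ?S"
    obtain f s e where u_eq: "u = (f, s, e)" by (cases u)
    have s: "f \<in> idempotents S" "e \<in> idempotents S" "s \<in> carrier S" "s \<odot>\<^bsub>S\<^esub> e = s"
      using u by (auto simp: u_eq S.splitting_arr_iff)
    note cl = s(1-3) p r lact_closed angle_closed S.mult_closed
    \<comment> \<open>The composite functor turns out to send \<open>s\<close> to its conjugate, the
      product of the middle entries of \<open>\<eta> f\<close>, \<open>u\<close> and
      \<open>\<theta> e\<close>.\<close>
    have "angle (r f) (ract (r e) (star T (square (p f) (lact s (p e)))))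
        = angle (r f) (lact (angle (r e) (lact s (p e))) (p f))"
      by (simp add: cl angle_square flip: square_star)
    also have "\<dots> = angle (r f) (p f) \<odot>\<^bsub>S\<^esub> (s \<odot>\<^bsub>S\<^esub> angle (p e) (r e))"
      using angle_star[of "r e" "lact s (p e)"]
      by (simp add: cl angle_lact_right[of _ "r f"] angle_lact)
    finally have GFu: "on_arr ?GF u = (angle (r f) (r f),
        angle (r f) (p f) \<odot>\<^bsub>S\<^esub> (s \<odot>\<^bsub>S\<^esub> angle (p e) (r e)), angle (r e) (r e))"
      by (simp add: comp_functor_def u_eq r_def)
    \<comment> \<open>The last two brackets multiply to \<open>e\<close>, which \<open>s\<close>
      absorbs.\<close>
    have "angle (r f) (p f) \<odot>\<^bsub>S\<^esub> (s \<odot>\<^bsub>S\<^esub> angle (p e) (r e)) \<odot>\<^bsub>S\<^esub> angle (r e) (p e)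
        = angle (r f) (p f) \<odot>\<^bsub>S\<^esub> s"
      by (simp add: cl S.mult_assoc pr s(4))
    then show "Comp ?S (on_arr ?GF u) (\<eta> (Dom ?S u)) = Comp ?S (\<eta> (Cod ?S u)) (on_arr id_functor u)"
      unfolding GFu by (simp add: u_eq \<eta>_def id_functor_def)
  qed
  then show ?thesis by blast
qed

section \<open>Assembling the equivalence\<close>

theorem equivalence_splittings:
  "\<exists>F. equivalence_of_categories (idempotent_splitting S) (idempotent_splitting T) F"
proof -
  interpret sw: morita_context T S X "\<lambda>t x. ract x (star T t)" "\<lambda>x s. lact (star S s) x" square angle
    by (rule swapped)
  obtain p where p: "\<And>e. e \<in> idempotents S \<Longrightarrow> p e \<in> X"
      "\<And>e. e \<in> idempotents S \<Longrightarrow> angle (p e) (p e) = e"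
    using idem_eq_angle_self by metis
  obtain q where q: "\<And>g. g \<in> idempotents T \<Longrightarrow> q g \<in> X"
      "\<And>g. g \<in> idempotents T \<Longrightarrow> square (q g) (q g) = g"
    using sw.idem_eq_angle_self by metis
  let ?F = "morita_functor lact square p"
  \<comment> \<open>Swapping the context twice produces this functor rather than \<open>?F\<close>;
    the double \<open>star\<close> cancels on all arguments that occur on arrows.\<close>
  let ?F' = "morita_functor (\<lambda>s x. lact (star S (star S s)) x) square p"
  let ?G = "morita_functor (\<lambda>t x. ract x (star T t)) angle q"
  have F: "cat_functor (idempotent_splitting S) (idempotent_splitting T) ?F"
    by (rule morita_functor[OF p])
  have G: "cat_functor (idempotent_splitting T) (idempotent_splitting S) ?G"
    by (rule sw.morita_functor[OF q])
  obtain \<eta> where \<eta>: "natural_isomorphism (idempotent_splitting S) (idempotent_splitting S)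
      id_functor (comp_functor ?G ?F) \<eta>"
    using unit_natural_isomorphism[OF p q] by blast
  obtain \<delta> where \<delta>: "natural_isomorphism (idempotent_splitting T) (idempotent_splitting T)
      id_functor (comp_functor ?F' ?G) \<delta>"
    using sw.unit_natural_isomorphism[OF q p] by blast
  have "natural_isomorphism (idempotent_splitting T) (idempotent_splitting T)
      id_functor (comp_functor ?F ?G) \<delta>"
  proof (rule natural_isomorphism_cong[OF \<delta> cat_functor_comp[OF G F]])
    fix u assume u: "u \<in> Arr (idempotent_splitting T)"
    obtain g t h where u_eq: "u = (g, t, h)" by (cases u)
    have "g \<in> idempotents T" "h \<in> idempotents T" "t \<in> carrier T"
      using u by (auto simp: u_eq T.splitting_arr_iff)
    then show "on_arr (comp_functor ?F ?G) u = on_arr (comp_functor ?F' ?G) u"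
      by (simp add: u_eq comp_functor_def S.star_star angle_closed q ract_closed T.star_closed)
  qed (simp add: comp_functor_def)
  \<comment> \<open>An equivalence asks for an isomorphism into the identity functor here, so
    \<open>\<delta>\<close> has to be inverted.\<close>
  from natural_isomorphism_sym[OF this] show ?thesis
    unfolding equivalence_of_categories_def using F G \<eta> by blast
qed

end

theorem theorem5p1:
  fixes S :: "'a semigroup_struct" and T :: "'b semigroup_struct"
  assumes "inverse_semigroup S" and "inverse_semigroup T"
    and "strongly_morita_equivalent TYPE('x) S T"
  shows "\<exists>F. equivalence_of_categories (idempotent_splitting S) (idempotent_splitting T) F"
  using assms(3) morita_context.equivalence_splittings
  unfolding strongly_morita_equivalent_def by blast

end
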